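(* Let $d\ge 3$, let $P:\mathbb{R}\to\mathbb{R}^{d-1}$ be a polynomial, and let $0 \leq \theta \leq 1$. Assume that $\rho$ is a positive Borel measure on $\mathbb{R}$ such that for any Borel sets $E$, $F$ in $\mathbb{R}^d$, we have $$\int_{\mathbb{R}^{d}} X^P \chi_E(t,y)\, \chi_F(t,y)\, d\rho(t)\, dy \leq C\, |E|^{\frac1{p_\theta}}\, \|\chi_F\|_{L^{q_\theta'}(L^{r_\theta'})}$$ for some constant $C$ (independent of $E$, $F$). Then $\rho$ is absolutely continuous with respect to Lebesgue measure and its Radon--Nikodym derivative satisfies $$\frac{d\rho}{dt}(t) \leq C_d\, C\,|L_P(t)|^{\frac{2\theta}{(d+2)(d-1)}},$$ for some constant $C_d$ depending only on $d$, where the constant $C$ is the same in both inequalities.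
   Context: For a polynomial map $P:\mathbb{R}\to\mathbb{R}^{d-1}$, the torsion is $L_P(t) = \det(P'(t),P''(t),\ldots,P^{(d-1)}(t))$, and the (unweighted) restricted X-ray transform is $X^P f(t,y) = \int_{\mathbb{R}} f(s,y+sP(t))\, ds$ for $(t,y)\in\mathbb{R}\times\mathbb{R}^{d-1}$. The exponents are defined by $$\bigl(p_{\theta}^{-1},q_{\theta}^{-1},r_{\theta}^{-1}\bigr) = \left(1-\theta + \frac{\theta d}{d+2},\ \frac{\theta d}{d+2},\ 1-\theta + \frac{\theta(d^2-d-2)}{d^2+d-2}\right).$$ The mixed norm (with respect to Lebesgue measure in both variables) is $\|g\|_{L^q(L^r)} = \bigl(\int_{\mathbb{R}}\bigl(\int_{\mathbb{R}^{d-1}} |g(t,y)|^r\, dy\bigr)^{q/r}\, dt\bigr)^{1/q}$, with the usual modification when an exponent is $\infty$. Primes denote Hölder conjugate exponents and $|E|$ is Lebesgue measure. When $\theta=0$ the weight $|L_P(t)|^{2\theta/((d+2)(d-1))}$ is understood to be identically $1$. *)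

theory Defs
  imports "HOL-Probability.Probability"
begin

definition nth_vderiv :: "nat \<Rightarrow> (real \<Rightarrow> 'a::real_normed_vector) \<Rightarrow> real \<Rightarrow> 'a" where
  "nth_vderiv k f = ((\<lambda>g t. vector_derivative g (at t)) ^^ k) f"

text \<open>The order on the index type numbers the columns: if \<open>j\<close> is the \<open>k\<close>-th smallest index
  (counting from 1), then \<open>card {..j} = k\<close> and column \<open>j\<close> is the \<open>k\<close>-th derivative.\<close>

definition torsion :: "(real \<Rightarrow> real ^ 'n::{finite,linorder}) \<Rightarrow> real \<Rightarrow> real" where
  "torsion P t = det (\<chi> i j. nth_vderiv (card {..j}) P t $ i)"

definition xray ::
  "(real \<Rightarrow> real ^ 'n::finite) \<Rightarrow> (real \<times> (real ^ 'n) \<Rightarrow> ennreal) \<Rightarrow> real \<times> (real ^ 'n) \<Rightarrow> ennreal" where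
  "xray P f = (\<lambda>(t, y). \<integral>\<^sup>+ s. f (s, y + s *\<^sub>R P t) \<partial>lborel)"

text \<open>Powers of an extended nonnegative number, meant for real exponents \<open>a > 0\<close> only.\<close>

definition epowr :: "ennreal \<Rightarrow> real \<Rightarrow> ennreal" where
  "epowr x a = (if x = \<infinity> then \<infinity> else ennreal (enn2real x powr a))"

definition Lnorm :: "ennreal \<Rightarrow> 'a measure \<Rightarrow> ('a \<Rightarrow> ennreal) \<Rightarrow> ennreal" where
  "Lnorm p M f =
     (if p = \<infinity> then esssup M f
      else epowr (\<integral>\<^sup>+ x. epowr (f x) (enn2real p) \<partial>M) (1 / enn2real p))"

definition mixed_norm ::
  "ennreal \<Rightarrow> ennreal \<Rightarrow> (real \<times> (real ^ 'n::finite) \<Rightarrow> ennreal) \<Rightarrow> ennreal" where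
  "mixed_norm q r g = Lnorm q lborel (\<lambda>t. Lnorm r lborel (\<lambda>y. g (t, y)))"

text \<open>Exponents live in \<^typ>\<open>ennreal\<close>, where \<open>inverse 0 = \<infinity>\<close> and \<open>inverse \<infinity> = 0\<close>.\<close>

definition conj_exponent :: "ennreal \<Rightarrow> ennreal" where
  "conj_exponent p = inverse (1 - inverse p)"

definition p_exponent :: "nat \<Rightarrow> real \<Rightarrow> ennreal" where
  "p_exponent d \<theta> = inverse (ennreal (1 - \<theta> + \<theta> * real d / (real d + 2)))"

definition q_exponent :: "nat \<Rightarrow> real \<Rightarrow> ennreal" where
  "q_exponent d \<theta> = inverse (ennreal (\<theta> * real d / (real d + 2)))"

definition r_exponent :: "nat \<Rightarrow> real \<Rightarrow> ennreal" where
  "r_exponent d \<theta> =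
     inverse (ennreal (1 - \<theta> + \<theta> * ((real d)\<^sup>2 - real d - 2) / ((real d)\<^sup>2 + real d - 2)))"

text \<open>The case distinction is needed because \<open>0 powr 0 = 0\<close> in HOL.\<close>

definition torsion_weight ::
  "nat \<Rightarrow> real \<Rightarrow> (real \<Rightarrow> real ^ 'n::{finite,linorder}) \<Rightarrow> real \<Rightarrow> real" where
  "torsion_weight d \<theta> P t =
     (if \<theta> = 0 then 1
      else \<bar>torsion P t\<bar> powr (2 * \<theta> / ((real d + 2) * (real d - 1))))"

text \<open>No \<open>\<sigma>\<close>-finiteness of \<open>\<rho>\<close> is needed for the product measure to be meaningful: the second factor
  is \<open>\<sigma>\<close>-finite, so integrals over it are iterated integrals, first in \<open>y\<close> and then in \<open>t\<close>.\<close>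

definition restricted_xray_bound ::
  "nat \<Rightarrow> real \<Rightarrow> (real \<Rightarrow> real ^ 'n::finite) \<Rightarrow> real measure \<Rightarrow> real \<Rightarrow> bool" where
  "restricted_xray_bound d \<theta> P \<rho> C \<longleftrightarrow>
     (\<forall>E F :: (real \<times> (real ^ 'n)) set. E \<in> sets borel \<longrightarrow> F \<in> sets borel \<longrightarrow>
        (\<integral>\<^sup>+ z. xray P (indicator E) z * indicator F z \<partial>(\<rho> \<Otimes>\<^sub>M lborel))
        \<le> ennreal C * epowr (emeasure lborel E) (1 / enn2real (p_exponent d \<theta>))
            * mixed_norm (conj_exponent (q_exponent d \<theta>)) (conj_exponent (r_exponent d \<theta>))
                (indicator F))"

end

theory Submission imports Defs begin

text \<open>At every point \<open>t0\<close> the hypothesis is tested on a Knapp example. A Gram--Schmidt argument gives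
  orthonormal vectors \<open>q j\<close> such that \<open>q j\<close> is orthogonal to all derivatives of \<open>P\<close> at \<open>t0\<close> of order
  between \<open>1\<close> and \<open>j - 1\<close>; in this frame the \<open>j\<close>-th component of \<open>P t - P t0\<close> is at most
  \<open>r j = c j * h ^ j\<close> for \<open>\<bar>t - t0\<bar> \<le> h\<close>, where \<open>c j\<close> exceeds the modulus of the \<open>j\<close>-th diagonal entry of the triangularised
  derivative matrix by an arbitrarily small \<open>\<eta> > 0\<close>. Take for \<open>F\<close> the interval of radius \<open>h\<close> times the
  box with half sides \<open>r j\<close>, and for \<open>E\<close> the unit length tube in direction \<open>P t0\<close> over the doubled box.
  The powers of \<open>h\<close> add up to exactly \<open>1\<close>, and the product of the \<open>c j\<close> tends to the absolute value of
  the torsion as \<open>\<eta>\<close> tends to \<open>0\<close>, so \<open>\<rho>\<close> has upper density at most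
  \<open>4 ^ d * C * torsion_weight d \<theta> P t0\<close> at \<open>t0\<close>. The frame exists also where the torsion
  vanishes, so such points need no separate treatment. A bisection argument turns the pointwise density bound
  into a bound on intervals, and coverings by intervals extend it to Borel sets.\<close>

section \<open>Triangular determinants, orthonormal frames and rotation invariance of volume\<close>

text \<open>If \<open>i\<close> is the least point that is moved, then \<open>p i < i\<close> is
  fixed by minimality, so \<open>p\<close> takes the value \<open>p i\<close> at both
  \<open>i\<close> and \<open>p i\<close>, against injectivity.\<close>

lemma permutes_below_id:
  fixes p :: "'n::{finite,linorder} \<Rightarrow> 'n"
  assumes p: "p permutes UNIV" and le: "\<And>i. p i \<le> i"
  shows "p = id"
proof (rule ccontr)
  assume "p \<noteq> id"
  define i where "i = Min {i. p i \<noteq> i}"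
  have "{i. p i \<noteq> i} \<noteq> {}" using \<open>p \<noteq> id\<close> by (auto simp: fun_eq_iff)
  then have i: "p i \<noteq> i" using Min_in[of "{i. p i \<noteq> i}"] by (auto simp: i_def)
  then have "p i < i" using le[of i] by simp
  have "p (p i) = p i"
  proof (rule ccontr)
    assume "p (p i) \<noteq> p i"
    then have "i \<le> p i" unfolding i_def by (intro Min_le) auto
    with \<open>p i < i\<close> show False by simp
  qed
  then show False using i permutes_inj[OF p] by (auto dest: injD)
qed

text \<open>A permutation with \<open>i \<le> p i\<close> everywhere has an inverse that never moves
  a point up, hence is the identity. Every other permutation therefore picks an entry below the
  diagonal, and only the identity survives in the Leibniz sum.\<close>

lemma det_upper_triangular:
  fixes A :: "'a::comm_ring_1^'n::{finite,linorder}^'n::_"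
  assumes ut: "\<And>i j. j < i \<Longrightarrow> A $ i $ j = 0"
  shows "det A = (\<Prod>i\<in>UNIV. A $ i $ i)"
proof -
  have *: "(\<Prod>i\<in>UNIV. A $ i $ p i) = 0" if p: "p permutes UNIV" "p \<noteq> id" for p
  proof -
    have "\<exists>i. p i < i"
    proof (rule ccontr)
      assume "\<nexists>i. p i < i"
      then have *: "i \<le> p i" for i by (simp add: not_less)
      have "inv p = id"
      proof (rule permutes_below_id)
        show "inv p permutes UNIV" using p(1) by (rule permutes_inv)
        show "inv p i \<le> i" for i
          using *[of "inv p i"] permutes_inverses(1)[OF p(1)] by simp
      qed
      then show False using p by (metis inv_id permutes_inv_inv)
    qed
    then show ?thesis using ut by (auto intro!: prod_zero)
  qed
  have "det A = (\<Sum>p\<in>{id}. of_int (sign p) * (\<Prod>i\<in>UNIV. A $ i $ p i))"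
    unfolding det_def
    by (rule sum.mono_neutral_right) (auto simp: finite_permutations permutes_id *)
  then show ?thesis by simp
qed

text \<open>Gram-Schmidt run from the largest index downwards. The vector for \<open>b\<close> must
  be orthogonal to \<open>M k\<close> for \<open>k < b\<close> and to the \<open>q i\<close> already
  chosen for larger \<open>i\<close>. These conditions are indexed by distinct elements other than
  \<open>b\<close>, so there are fewer than the dimension and a unit solution exists, even if the
  \<open>M k\<close> are linearly dependent.\<close>

lemma orthonormal_triangularization:
  fixes M :: "'n::{finite,linorder} \<Rightarrow> real^'n::_"
  obtains q where "\<And>i. norm (q i) = 1" "\<And>i j. i \<noteq> j \<Longrightarrow> q i \<bullet> q j = 0"
    "\<And>i k. k < i \<Longrightarrow> q i \<bullet> M k = 0"
proof -
  have "\<exists>q. (\<forall>i\<in>A. norm (q i) = 1) \<and>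
      (\<forall>i\<in>A. \<forall>j\<in>A. i \<noteq> j \<longrightarrow> q i \<bullet> q j = 0) \<and> (\<forall>i\<in>A. \<forall>k<i. q i \<bullet> M k = 0)"
    if "finite A" for A
    using that
  proof (induction A rule: finite_linorder_min_induct)
    case empty
    then show ?case by auto
  next
    case (insert b A)
    then obtain q where q: "\<forall>i\<in>A. norm (q i) = 1"
      "\<forall>i\<in>A. \<forall>j\<in>A. i \<noteq> j \<longrightarrow> q i \<bullet> q j = 0" "\<forall>i\<in>A. \<forall>k<i. q i \<bullet> M k = 0" by blast
    define S where "S = M ` {..<b} \<union> q ` A"
    have "card S \<le> card {..<b} + card A"
      unfolding S_def by (meson add_mono card_Un_le card_image_le finite le_trans)
    also have "\<dots> = card ({..<b} \<union> A)"
      using insert by (subst card_Un_disjoint) auto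
    also have "\<dots> < card (UNIV :: 'n set)"
      using insert by (intro psubset_card_mono) auto
    finally have "card S < DIM((real, 'n) vec)" by simp
    moreover have "dim S \<le> card S" by (rule dim_le_card') (simp add: S_def)
    ultimately have "dim S < DIM((real, 'n) vec)" by simp
    then obtain x where x: "x \<noteq> 0" "\<And>y. y \<in> span S \<Longrightarrow> orthogonal x y"
      using orthogonal_to_subspace_exists[of S] by blast
    define u where "u = x /\<^sub>R norm x"
    have u: "norm u = 1" "\<And>y. y \<in> S \<Longrightarrow> u \<bullet> y = 0" "\<And>y. y \<in> S \<Longrightarrow> y \<bullet> u = 0"
      using x by (auto simp: u_def orthogonal_def span_base inner_commute)
    show ?case
    proof (intro exI[of _ "q(b := u)"] conjI)
      show "\<forall>i\<in>insert b A. norm ((q(b := u)) i) = 1" using q u by auto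
      show "\<forall>i\<in>insert b A. \<forall>j\<in>insert b A. i \<noteq> j \<longrightarrow> (q(b := u)) i \<bullet> (q(b := u)) j = 0"
        using q u by (auto simp: S_def)
      show "\<forall>i\<in>insert b A. \<forall>k<i. (q(b := u)) i \<bullet> M k = 0"
        using q u by (auto simp: S_def)
    qed
  qed
  from this[of UNIV] show ?thesis using that by auto
qed

lemma orthogonal_matrix_rows:
  fixes q :: "'n::finite \<Rightarrow> real^'n::_"
  assumes "\<And>i. norm (q i) = 1" "\<And>i j. i \<noteq> j \<Longrightarrow> q i \<bullet> q j = 0"
  shows "orthogonal_matrix (\<chi> i. q i)"
  using assms
  by (auto simp: orthogonal_matrix_orthonormal_rows row_def orthogonal_def)

text \<open>Multiplying on the left by the orthogonal matrix with rows \<open>q i\<close> makes the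
  matrix with columns \<open>M j\<close> upper triangular and does not change the modulus of its
  determinant.\<close>

lemma abs_det_triangularization:
  fixes M :: "'n::{finite,linorder} \<Rightarrow> real^'n::_"
  assumes q: "\<And>i. norm (q i) = 1" "\<And>i j. i \<noteq> j \<Longrightarrow> q i \<bullet> q j = 0"
    "\<And>i k. k < i \<Longrightarrow> q i \<bullet> M k = 0"
  shows "\<bar>det (\<chi> i j. M j $ i)\<bar> = (\<Prod>i\<in>UNIV. \<bar>q i \<bullet> M i\<bar>)"
proof -
  define Q where "Q = (\<chi> i. q i)"
  have "\<bar>det Q\<bar> = 1"
    using det_orthogonal_matrix[of Q] orthogonal_matrix_rows[OF q(1,2)] by (auto simp: Q_def)
  have *: "(Q ** (\<chi> i j. M j $ i)) $ i $ j = q i \<bullet> M j" for i j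
    by (simp add: matrix_matrix_mult_def Q_def inner_vec_def)
  have "det (Q ** (\<chi> i j. M j $ i)) = (\<Prod>i\<in>UNIV. q i \<bullet> M i)"
    by (subst det_upper_triangular) (auto simp: * q)
  then have "\<bar>det Q\<bar> * \<bar>det (\<chi> i j. M j $ i)\<bar> = (\<Prod>i\<in>UNIV. \<bar>q i \<bullet> M i\<bar>)"
    by (simp add: det_mul abs_mult[symmetric] abs_prod)
  then show ?thesis using \<open>\<bar>det Q\<bar> = 1\<close> by simp
qed

text \<open>Uniqueness of Haar measure, with the rotation invariant unit ball as test set: both sides of
  the claim, multiplied by the volume of the ball, are the two iterated integrals of
  \<open>(x, z) \<mapsto> indicator (ball 0 1) x * indicator B (x + T z)\<close>.\<close>

lemma distr_lborel_orthogonal: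
  fixes T :: "'a::euclidean_space \<Rightarrow> 'a"
  assumes T: "orthogonal_transformation T"
  shows "distr lborel borel T = lborel"
proof (rule measure_eqI)
  show "sets (distr lborel borel T) = sets lborel" by simp
  fix B assume "B \<in> sets (distr lborel borel T)"
  then have [measurable]: "B \<in> sets borel" by simp
  have lin: "linear T" using T by (rule orthogonal_transformation_linear)
  then have [measurable]: "T \<in> borel_measurable borel"
    by (intro borel_measurable_continuous_onI linear_continuous_on linear_conv_bounded_linear[THEN iffD1])
  define b :: "'a set" where "b = ball 0 1"
  have [measurable]: "b \<in> sets borel" by (simp add: b_def)
  have bpos: "emeasure lborel b \<noteq> 0" "emeasure lborel b \<noteq> \<infinity>"
    using open_not_negligible[of b] emeasure_bounded_finite[of b]
    by (auto simp: b_def negligible_iff_emeasure0 emeasure_completion)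
  have trans: "(\<integral>\<^sup>+ x. f (x + c) \<partial>lborel) = (\<integral>\<^sup>+ x. f x \<partial>lborel)"
    if [measurable]: "f \<in> borel_measurable borel" for f :: "'a \<Rightarrow> ennreal" and c
    using nn_integral_distr[of "(+) c" lborel borel f] by (simp add: lborel_distr_plus add.commute)
  have "emeasure lborel b * emeasure (distr lborel borel T) B =
      (\<integral>\<^sup>+ x. indicator b x * emeasure (distr lborel borel T) B \<partial>lborel)"
    by (simp add: nn_integral_multc)
  also have "\<dots> = (\<integral>\<^sup>+ x. indicator b x * (\<integral>\<^sup>+ z. indicator B (x + T z) \<partial>lborel) \<partial>lborel)"
  proof (intro nn_integral_cong arg_cong2[where f="(*)"] refl)
    fix x
    obtain y where y: "x = T y" using orthogonal_transformation_surj[OF T] by auto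
    have "(\<integral>\<^sup>+ z. indicator B (x + T z) \<partial>lborel) = (\<integral>\<^sup>+ z. indicator B (T (z + y)) \<partial>lborel)"
      using lin by (simp add: y linear_add add.commute)
    also have "\<dots> = (\<integral>\<^sup>+ z. indicator B (T z) \<partial>lborel)"
      by (rule trans[of "\<lambda>z. indicator B (T z)"]) measurable
    also have "\<dots> = emeasure (distr lborel borel T) B"
      by (subst nn_integral_distr[of T lborel borel "indicator B", symmetric]) auto
    finally show "emeasure (distr lborel borel T) B = (\<integral>\<^sup>+ z. indicator B (x + T z) \<partial>lborel)" by simp
  qed
  also have "\<dots> = (\<integral>\<^sup>+ x. \<integral>\<^sup>+ z. indicator b x * indicator B (x + T z) \<partial>lborel \<partial>lborel)"
    by (intro nn_integral_cong nn_integral_cmult[symmetric]; measurable)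
  also have "\<dots> = (\<integral>\<^sup>+ z. \<integral>\<^sup>+ x. indicator b x * indicator B (x + T z) \<partial>lborel \<partial>lborel)"
    by (rule lborel_pair.Fubini'[symmetric]; measurable)
  also have "\<dots> = (\<integral>\<^sup>+ z. \<integral>\<^sup>+ x. indicator b (x - T z) * indicator B x \<partial>lborel \<partial>lborel)"
  proof (rule nn_integral_cong)
    fix z
    show "(\<integral>\<^sup>+ x. indicator b x * indicator B (x + T z) \<partial>lborel) =
        (\<integral>\<^sup>+ x. indicator b (x - T z) * indicator B x \<partial>lborel)"
      using trans[of "\<lambda>x. indicator b (x - T z) * indicator B x" "T z"] by simp
  qed
  also have "\<dots> = (\<integral>\<^sup>+ x. \<integral>\<^sup>+ z. indicator b (x - T z) * indicator B x \<partial>lborel \<partial>lborel)"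
    by (rule lborel_pair.Fubini'; measurable)
  also have "\<dots> = (\<integral>\<^sup>+ x. emeasure lborel b * indicator B x \<partial>lborel)"
  proof (intro nn_integral_cong)
    fix x
    obtain y where y: "x = T y" using orthogonal_transformation_surj[OF T] by auto
    have "x - T z = T (y - z)" for z using lin by (simp add: y linear_diff)
    then have "indicator b (x - T z) = (indicator b (z + (- y)) :: ennreal)" for z
      using orthogonal_transformation_norm[OF T, of "y - z"]
      by (simp add: b_def indicator_def norm_minus_commute)
    then have "(\<integral>\<^sup>+ z. indicator b (x - T z) * indicator B x \<partial>lborel) =
       (\<integral>\<^sup>+ z. indicator b (z + (- y)) * indicator B x \<partial>lborel)" by simp
    also have "\<dots> = emeasure lborel b * indicator B x"
      by (subst trans[of "\<lambda>z. indicator b z * indicator B x"]) (simp_all add: nn_integral_multc)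
    finally show "(\<integral>\<^sup>+ z. indicator b (x - T z) * indicator B x \<partial>lborel) = emeasure lborel b * indicator B x" .
  qed
  also have "\<dots> = emeasure lborel b * emeasure lborel B"
    by (simp add: nn_integral_cmult)
  finally show "emeasure (distr lborel borel T) B = emeasure lborel B"
    using bpos by (simp add: ennreal_mult_cancel_left)
qed

section \<open>Volumes of rotated boxes\<close>

text \<open>For an orthonormal frame \<open>q\<close> this is the closed box centred at the origin
  with axes \<open>q j\<close> and half sides \<open>r j\<close>.\<close>

definition slabs :: "('n::finite \<Rightarrow> real^'n) \<Rightarrow> ('n \<Rightarrow> real) \<Rightarrow> (real^'n) set" where
  "slabs q r = {y. \<forall>j. \<bar>q j \<bullet> y\<bar> \<le> r j}"

lemma closed_slabs: "closed (slabs q r)"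
  unfolding slabs_def by (intro closed_Collect_all closed_Collect_le continuous_intros)

lemma slabs_borel [measurable]: "slabs q r \<in> sets borel"
  by (rule borel_closed[OF closed_slabs])

text \<open>The orthogonal map with rows \<open>q i\<close> takes the rotated box to a coordinate
  box and preserves Lebesgue measure.\<close>

lemma emeasure_slabs:
  fixes q :: "'n::finite \<Rightarrow> real^'n::_"
  assumes q: "\<And>i. norm (q i) = 1" "\<And>i j. i \<noteq> j \<Longrightarrow> q i \<bullet> q j = 0"
    and r: "\<And>j. 0 \<le> r j"
  shows "emeasure lborel (slabs q r) = ennreal (\<Prod>j\<in>UNIV. 2 * r j)"
proof -
  define T where "T = (\<lambda>y. (\<chi> i. q i) *v y)"
  have T: "orthogonal_transformation T"
    using orthogonal_matrix_rows[OF q] by (simp add: T_def orthogonal_transformation_matrix)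
  have [measurable]: "T \<in> borel_measurable borel"
    using orthogonal_transformation_linear[OF T]
    by (intro borel_measurable_continuous_onI linear_continuous_on linear_conv_bounded_linear[THEN iffD1])
  define b :: "real^'n" where "b = (\<chi> j. r j)"
  have Tj: "T y $ j = q j \<bullet> y" for y j
    by (simp add: T_def matrix_vector_mult_def inner_vec_def)
  have "(y \<in> slabs q r) = (T y \<in> cbox (-b) b)" for y
    by (auto simp: slabs_def Tj b_def mem_box_cart abs_le_iff minus_le_iff)
  then have "slabs q r = T -` cbox (-b) b" by auto
  then have "emeasure lborel (slabs q r) = emeasure (distr lborel borel T) (cbox (-b) b)"
    by (subst emeasure_distr) auto
  also have "\<dots> = ennreal (\<Prod>i\<in>Basis. (b - - b) \<bullet> i)"
    unfolding distr_lborel_orthogonal[OF T]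
    using r by (intro emeasure_lborel_cbox) (auto simp: Basis_vec_def inner_axis b_def)
  also have "(\<Prod>i\<in>Basis. (b - - b) \<bullet> i) = (\<Prod>j\<in>UNIV. 2 * r j)"
    by (simp add: Basis_vec_def prod.UNION_disjoint inner_axis axis_eq_axis b_def
       prod.reindex inj_on_def image_UN[symmetric] UNION_singleton_eq_range)
  finally show ?thesis .
qed

section \<open>Conjugate exponents and norms of indicator functions\<close>

text \<open>Exponents are handled through their reciprocals throughout, so that the infinite
  exponent, with reciprocal \<open>0\<close>, is covered at both ends of the range.\<close>

lemma conj_exponent_inverse:
  assumes "0 \<le> x" "x \<le> 1"
  shows "conj_exponent (inverse (ennreal x)) = inverse (ennreal (1 - x))"
proof -
  have "inverse (inverse (ennreal x)) = ennreal x"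
    using assms by (cases "x = 0") (simp_all add: inverse_ennreal)
  then show ?thesis using assms by (simp add: conj_exponent_def ennreal_minus flip: ennreal_1)
qed

lemma epowr_ennreal: "0 \<le> x \<Longrightarrow> epowr (ennreal x) a = ennreal (x powr a)"
  by (simp add: epowr_def)

lemma enn2real_inverse_ennreal:
  assumes "0 < a"
  shows "enn2real (inverse (ennreal a)) = 1 / a"
  using assms by (simp add: inverse_ennreal inverse_eq_divide)

lemma Lnorm_indicator_le:
  assumes A: "A \<in> sets M" "emeasure M A = ennreal v" "0 < v" and a: "0 \<le> a" and k: "0 \<le> k"
  shows "Lnorm (inverse (ennreal a)) M (\<lambda>x. ennreal k * indicator A x) \<le> ennreal (k * v powr a)"
proof (cases "a = 0")
  case True
  \<comment> \<open>The exponent is infinite here; \<open>0 < v\<close> gives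
    \<open>v powr 0 = 1\<close>, so the claimed bound is just \<open>k\<close>.\<close>
  have "esssup M (\<lambda>x. ennreal k * indicator A x) \<le> ennreal k"
    using A by (intro esssup_I) (auto simp: indicator_def)
  then show ?thesis using True \<open>0 < v\<close> by (simp add: Lnorm_def)
next
  case False
  then have a: "0 < a" using a by simp
  have p: "inverse (ennreal a) \<noteq> \<infinity>" "enn2real (inverse (ennreal a)) = 1 / a"
    using a by (auto simp: enn2real_inverse_ennreal)
  have "epowr (ennreal k * indicator A x) (1 / a) = ennreal (k powr (1 / a)) * indicator A x" for x
    using k by (auto simp: indicator_def epowr_ennreal epowr_def)
  then have "(\<integral>\<^sup>+ x. epowr (ennreal k * indicator A x) (1 / a) \<partial>M) = ennreal (k powr (1 / a) * v)"
    using A by (simp add: nn_integral_cmult_indicator ennreal_mult)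
  moreover have "epowr (ennreal (k powr (1 / a) * v)) a = ennreal (k * v powr a)"
    using a k \<open>0 < v\<close> by (simp add: epowr_ennreal powr_mult powr_powr)
  ultimately show ?thesis using p by (simp add: Lnorm_def)
qed

text \<open>Two applications of the one-variable bound. The case \<open>b = 0\<close> has to be
  included because the inner exponent is infinite when \<theta> is \<open>0\<close>; the outer
  exponent stays finite for all admissible \<theta>, whence \<open>0 < a\<close>.\<close>

lemma mixed_norm_indicator_Times_le:
  fixes S :: "(real^'n::finite) set"
  assumes I: "I \<in> sets borel" "emeasure lborel I = ennreal u" "0 < u"
    and S: "S \<in> sets borel" "emeasure lborel S = ennreal v" "0 < v"
    and ab: "0 < a" "0 \<le> b"
  shows "mixed_norm (inverse (ennreal a)) (inverse (ennreal b)) (indicator (I \<times> S))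
    \<le> ennreal (v powr b * u powr a)"
proof -
  have p: "inverse (ennreal a) \<noteq> \<infinity>" "enn2real (inverse (ennreal a)) = 1 / a"
    using ab by (auto simp: enn2real_inverse_ennreal)
  have mono: "epowr x c \<le> epowr y c" if "x \<le> y" "0 < c" for x y c
    using that by (auto simp: epowr_def top_unique less_top intro!: ennreal_leI powr_mono2 enn2real_mono)
  have *: "Lnorm (inverse (ennreal b)) lborel (\<lambda>y. indicator (I \<times> S) (t, y))
      \<le> ennreal (v powr b) * indicator I t" for t
  proof -
    have "(\<lambda>y. indicator (I \<times> S) (t, y)) = (\<lambda>y. ennreal (indicator I t) * indicator S y)"
      by (auto simp: indicator_def fun_eq_iff)
    then show ?thesis
      using Lnorm_indicator_le[of S lborel v b "indicator I t"] S ab by (auto simp: indicator_def)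
  qed
  have "mixed_norm (inverse (ennreal a)) (inverse (ennreal b)) (indicator (I \<times> S))
      \<le> Lnorm (inverse (ennreal a)) lborel (\<lambda>t. ennreal (v powr b) * indicator I t)"
    using ab p unfolding mixed_norm_def Lnorm_def[of "inverse (ennreal a)"]
    by (auto intro!: mono nn_integral_mono *)
  also have "\<dots> \<le> ennreal (v powr b * u powr a)"
    using I ab by (intro Lnorm_indicator_le) auto
  finally show ?thesis .
qed

section \<open>The Knapp example: tubes and their X-ray transforms\<close>

lemma emeasure_lborel_translate:
  fixes c :: "'a::euclidean_space"
  assumes "S \<in> sets borel"
  shows "emeasure lborel {x. x - c \<in> S} = emeasure lborel S"
proof -
  have "emeasure (distr lborel borel ((+) (- c))) S = emeasure lborel {x. x - c \<in> S}"
    using assms by (subst emeasure_distr) (auto simp: vimage_def)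
  then show ?thesis by (simp add: lborel_distr_plus)
qed

definition tube :: "('n::finite \<Rightarrow> real^'n::_) \<Rightarrow> ('n \<Rightarrow> real) \<Rightarrow> (real, 'n) vec \<Rightarrow> (real \<times> (real, 'n) vec) set" where
  "tube q r v = {(s, x). \<bar>s\<bar> \<le> 1 \<and> x - s *\<^sub>R v \<in> slabs q r}"

lemma tube_borel [measurable]: "tube q r v \<in> sets borel"
proof (rule borel_closed)
  have "tube q r v = (\<lambda>z. fst z) -` {-1..1} \<inter> (\<lambda>z. snd z - fst z *\<^sub>R v) -` slabs q r"
    by (auto simp: tube_def)
  moreover have "closed \<dots>"
    by (intro closed_Int closed_vimage closed_slabs closed_atLeastAtMost continuous_intros)
  ultimately show "closed (tube q r v)" by simp
qed

text \<open>The tube is a sheared product: each fibre over \<open>s\<close> in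
  \<open>{-1..1}\<close> is a translate of the box, and this interval has length
  \<open>2\<close>.\<close>

lemma emeasure_tube: "emeasure lborel (tube q r v) = 2 * emeasure lborel (slabs q r)"
proof -
  have *: "emeasure lborel (Pair s -` tube q r v) = emeasure lborel (slabs q r) * indicator {-1..1} s" for s
  proof (cases "\<bar>s\<bar> \<le> 1")
    case True
    then have "Pair s -` tube q r v = {x. x - s *\<^sub>R v \<in> slabs q r}" by (auto simp: tube_def)
    then show ?thesis using True by (auto simp: emeasure_lborel_translate indicator_def)
  qed (auto simp: tube_def vimage_def indicator_def abs_le_iff)
  have "emeasure lborel (tube q r v) = emeasure (lborel \<Otimes>\<^sub>M lborel) (tube q r v)"
    by (simp add: lborel_prod)
  also have "\<dots> = (\<integral>\<^sup>+ s. emeasure lborel (Pair s -` tube q r v) \<partial>lborel)"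
    by (rule lborel.emeasure_pair_measure_alt) (simp only: lborel_prod sets_lborel tube_borel)
  also have "\<dots> = 2 * emeasure lborel (slabs q r)"
    by (simp add: * nn_integral_cmult_indicator mult.commute)
  finally show ?thesis .
qed

text \<open>Relative to the axis point \<open>s *\<^sub>R P t0\<close>, the line sits at
  \<open>y + s *\<^sub>R (P t - P t0)\<close>. For \<open>\<bar>s\<bar> \<le> 1\<close> both terms
  have \<open>j\<close>-th component at most \<open>r j\<close>, which is why the box is doubled,
  and the line stays in the tube for a parameter interval of length \<open>2\<close>.\<close>

lemma xray_tube_ge:
  fixes P :: "real \<Rightarrow> real^'n::finite"
  assumes close: "\<And>j. \<bar>q j \<bullet> (P t - P t0)\<bar> \<le> r j" and y: "y \<in> slabs q r"
  shows "2 \<le> xray P (indicator (tube q (\<lambda>j. 2 * r j) (P t0))) (t, y)"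
proof -
  have "(s, y + s *\<^sub>R P t) \<in> tube q (\<lambda>j. 2 * r j) (P t0)" if "\<bar>s\<bar> \<le> 1" for s
  proof -
    have "\<bar>q j \<bullet> (y + s *\<^sub>R P t - s *\<^sub>R P t0)\<bar> \<le> 2 * r j" for j
    proof -
      have "q j \<bullet> (y + s *\<^sub>R P t - s *\<^sub>R P t0) = q j \<bullet> y + s * (q j \<bullet> (P t - P t0))"
        by (simp add: algebra_simps inner_diff_right)
      moreover have "\<bar>q j \<bullet> y\<bar> \<le> r j" using y by (simp add: slabs_def)
      moreover have "\<bar>s * (q j \<bullet> (P t - P t0))\<bar> \<le> 1 * r j"
        unfolding abs_mult using that close[of j] by (intro mult_mono) auto
      ultimately show ?thesis by linarith
    qed
    then show ?thesis using that by (simp add: tube_def slabs_def)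
  qed
  then have "(\<integral>\<^sup>+ s. indicator {-1..1::real} s \<partial>lborel)
      \<le> xray P (indicator (tube q (\<lambda>j. 2 * r j) (P t0))) (t, y)"
    unfolding xray_def prod.case
    by (intro nn_integral_mono) (auto simp: indicator_def abs_le_iff)
  then show ?thesis by simp
qed

text \<open>With \<open>V\<close> the volume of the box, testing on the tube and on interval times
  box bounds \<open>V\<close> times the measure of the interval by a constant times
  \<open>V powr (\<alpha> + b) * h powr g\<close>. Dividing by \<open>V\<close> leaves exactly the
  exponent of the torsion weight on \<open>V\<close>.\<close>

lemma knapp_estimate:
  fixes P :: "real \<Rightarrow> real^'n::finite" and q :: "'n \<Rightarrow> real^'n::_"
  assumes d: "3 \<le> d" "CARD('n) = d - 1" and \<theta>: "0 \<le> \<theta>" "\<theta> \<le> 1" and C: "0 \<le> C"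
    and sets: "sets \<rho> = sets borel"
    and bound: "restricted_xray_bound d \<theta> P \<rho> C"
    and q: "\<And>i. norm (q i) = 1" "\<And>i j. i \<noteq> j \<Longrightarrow> q i \<bullet> q j = 0"
    and r: "\<And>j. 0 < r j" and h: "0 < h"
    and close: "\<And>t j. \<bar>t - t0\<bar> \<le> h \<Longrightarrow> \<bar>q j \<bullet> (P t - P t0)\<bar> \<le> r j"
  shows "emeasure \<rho> {t0 - h..t0 + h} \<le>
    ennreal (C * 2 ^ d * (\<Prod>j\<in>UNIV. 2 * r j) powr (2 * \<theta> / ((real d + 2) * (real d - 1)))
      * h powr (1 - \<theta> * real d / (real d + 2)))"
proof -
  define V where "V = (\<Prod>j\<in>UNIV. 2 * r j)"
  \<comment> \<open>\<open>\<alpha>\<close>, \<open>g\<close> and \<open>b\<close> are the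
    reciprocals of the exponent \<open>p\<close> and of the conjugates of \<open>q\<close> and
    \<open>r\<close>; \<open>\<kappa>\<close> is the exponent in
    \<open>torsion_weight\<close>.\<close>
  define \<alpha> where "\<alpha> = 1 - 2 * \<theta> / (real d + 2)"
  define g where "g = 1 - \<theta> * real d / (real d + 2)"
  define b where "b = 2 * \<theta> * real d / ((real d + 2) * (real d - 1))"
  define \<kappa> where "\<kappa> = 2 * \<theta> / ((real d + 2) * (real d - 1))"
  have d3: "real d \<ge> 3" using d by simp
  have "V > 0" unfolding V_def using r by (intro prod_pos) auto
  have \<alpha>: "0 < \<alpha>" "\<alpha> \<le> 1" using \<theta> d3 by (auto simp: \<alpha>_def field_simps)
  have "\<theta> * real d \<le> 1 * real d" using \<theta> by (intro mult_right_mono) auto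
  then have "\<theta> * real d < real d + 2" by linarith
  then have g: "0 < g" "g \<le> 1" using \<theta> d3 by (auto simp: g_def field_simps)
  have b: "0 \<le> b" using \<theta> d3 by (auto simp: b_def)
  have \<kappa>: "\<kappa> = \<alpha> + b - 1"
  proof -
    have "2 * \<theta> / (real d + 2) = 2 * \<theta> * (real d - 1) / ((real d + 2) * (real d - 1))"
      using d3 by simp
    then show ?thesis
      by (simp add: \<kappa>_def \<alpha>_def b_def diff_divide_distrib right_diff_distrib)
  qed
  have eb: "b = 1 - (1 - \<theta> + \<theta> * ((real d)\<^sup>2 - real d - 2) / ((real d)\<^sup>2 + real d - 2))"
  proof -
    have D: "(real d)\<^sup>2 + real d - 2 = (real d + 2) * (real d - 1)" by algebra
    have *: "1 - (1 - \<theta> + \<theta> * x / y) = \<theta> * (y - x) / y" if "y \<noteq> 0" for x y :: real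
      using that by (simp add: field_simps)
    have "(real d)\<^sup>2 + real d - 2 \<noteq> 0" unfolding D using d3 by simp
    then show ?thesis unfolding b_def by (subst *) (simp_all flip: D)
  qed
  have rexp: "0 \<le> 1 - \<theta> + \<theta> * ((real d)\<^sup>2 - real d - 2) / ((real d)\<^sup>2 + real d - 2)"
  proof -
    have "(real d)\<^sup>2 \<ge> 3 * real d" using d3 by (simp add: power2_eq_square)
    then show ?thesis using \<theta> d3 by (intro add_nonneg_nonneg divide_nonneg_nonneg mult_nonneg_nonneg) auto
  qed
  have pe: "1 / enn2real (p_exponent d \<theta>) = \<alpha>"
  proof -
    have e: "1 - \<theta> + \<theta> * real d / (real d + 2) = \<alpha>" using d3 by (simp add: \<alpha>_def field_simps)
    show ?thesis unfolding p_exponent_def e using \<alpha> by (simp add: enn2real_inverse_ennreal)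
  qed
  have qe: "conj_exponent (q_exponent d \<theta>) = inverse (ennreal g)"
    unfolding q_exponent_def g_def using \<theta> g d3
    by (intro conj_exponent_inverse) (auto simp: g_def)
  have re: "conj_exponent (r_exponent d \<theta>) = inverse (ennreal b)"
    unfolding r_exponent_def eb using b rexp
    by (intro conj_exponent_inverse) (auto simp: eb)
  define B where "B = slabs q r"
  define I where "I = {t0 - h..t0 + h}"
  define E where "E = tube q (\<lambda>j. 2 * r j) (P t0)"
  have V: "emeasure lborel B = ennreal V"
    unfolding B_def V_def using q r by (intro emeasure_slabs) (auto intro: less_imp_le)
  have [measurable]: "B \<in> sets borel" "I \<in> sets borel" "E \<in> sets borel"
    by (auto simp: B_def I_def E_def)
  have I: "emeasure lborel I = ennreal (2 * h)" using h by (simp add: I_def)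
  \<comment> \<open>Doubling \<open>d - 1\<close> half sides gives \<open>2 ^ (d - 1)\<close>, and
    the length of the tube gives one more factor \<open>2\<close>.\<close>
  have "emeasure lborel E = ennreal (2 ^ d * V)"
  proof -
    have "emeasure lborel E = 2 * ennreal (\<Prod>j\<in>UNIV. 2 * (2 * r j))"
      unfolding E_def emeasure_tube using q r
      by (subst emeasure_slabs) (auto intro: less_imp_le)
    also have "(\<Prod>j\<in>UNIV. 2 * (2 * r j)) = 2 ^ (d - 1) * V"
      unfolding V_def by (subst prod.distrib) (simp add: d(2))
    also have "2 * ennreal (2 ^ (d - 1) * V) = ennreal (2 * (2 ^ (d - 1) * V))"
      using \<open>V > 0\<close> by (simp add: ennreal_mult)
    also have "2 * (2 ^ (d - 1) * V) = 2 ^ d * V"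
      using d(1) by (cases d) auto
    finally show ?thesis .
  qed
  then have Ep: "epowr (emeasure lborel E) \<alpha> = ennreal ((2 ^ d * V) powr \<alpha>)"
    using \<open>V > 0\<close> by (simp add: epowr_ennreal)
  have IB: "I \<times> B \<in> sets (\<rho> \<Otimes>\<^sub>M lborel)" using sets by (intro pair_measureI) auto
  \<comment> \<open>The factor \<open>2\<close> is the lower bound for the X-ray transform on
    \<open>I \<times> B\<close>; together with \<open>V\<close> it is cancelled at the end.\<close>
  have "2 * (emeasure \<rho> I * ennreal V) = 2 * emeasure (\<rho> \<Otimes>\<^sub>M lborel) (I \<times> B)"
    using sets by (subst lborel.emeasure_pair_measure_Times) (auto simp: V)
  also have "\<dots> = (\<integral>\<^sup>+ z. 2 * indicator (I \<times> B) z \<partial>(\<rho> \<Otimes>\<^sub>M lborel))"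
    using IB by (simp add: nn_integral_cmult_indicator)
  also have "\<dots> \<le> (\<integral>\<^sup>+ z. xray P (indicator E) z * indicator (I \<times> B) z \<partial>(\<rho> \<Otimes>\<^sub>M lborel))"
  proof (rule nn_integral_mono)
    fix z
    show "2 * indicator (I \<times> B) z \<le> xray P (indicator E) z * indicator (I \<times> B) z"
    proof (cases "z \<in> I \<times> B")
      case True
      then obtain t y where z: "z = (t, y)" "\<bar>t - t0\<bar> \<le> h" "y \<in> slabs q r"
        by (auto simp: I_def B_def)
      then have "2 \<le> xray P (indicator E) z"
        unfolding E_def using close by (auto intro!: xray_tube_ge)
      then show ?thesis using True by simp
    qed simp
  qed
  also have "\<dots> \<le> ennreal C * epowr (emeasure lborel E) (1 / enn2real (p_exponent d \<theta>))
      * mixed_norm (conj_exponent (q_exponent d \<theta>)) (conj_exponent (r_exponent d \<theta>)) (indicator (I \<times> B))"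
    using bound[unfolded restricted_xray_bound_def, rule_format, of E "I \<times> B"]
    by (simp add: borel_Times)
  also have "\<dots> \<le> ennreal C * ennreal ((2 ^ d * V) powr \<alpha>) * ennreal (V powr b * (2 * h) powr g)"
    unfolding pe qe re Ep using I V h \<open>V > 0\<close> g b
    by (intro mult_left_mono mixed_norm_indicator_Times_le) auto
  also have "\<dots> = ennreal (C * (2 ^ d * V) powr \<alpha> * (V powr b * (2 * h) powr g))"
    using C by (simp add: ennreal_mult)
  \<comment> \<open>Both \<open>\<alpha>\<close> and \<open>g\<close> are at most \<open>1\<close>,
    so the powers of \<open>2\<close> are bounded independently of \<theta>.\<close>
  also have "\<dots> \<le> ennreal (2 * (C * 2 ^ d * V powr \<kappa> * h powr g) * V)"
  proof (rule ennreal_leI)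
    have "(2 ^ d :: real) powr \<alpha> \<le> (2 ^ d) powr 1" using \<alpha> by (intro powr_mono) auto
    moreover have "(2 :: real) powr g \<le> 2 powr 1" using g by (intro powr_mono) auto
    ultimately have *: "(2 ^ d :: real) powr \<alpha> * 2 powr g \<le> 2 ^ d * 2"
      by (intro mult_mono) auto
    have "V powr \<alpha> * V powr b = V powr (\<kappa> + 1)"
      unfolding \<kappa> by (simp add: powr_add[symmetric])
    then have **: "V powr \<alpha> * V powr b = V powr \<kappa> * V" using \<open>V > 0\<close> by (simp add: powr_add)
    have "C * (2 ^ d * V) powr \<alpha> * (V powr b * (2 * h) powr g) =
        (C * h powr g * (V powr \<alpha> * V powr b)) * ((2 ^ d) powr \<alpha> * 2 powr g)"
      using \<open>V > 0\<close> h by (simp add: powr_mult)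
    also have "\<dots> \<le> (C * h powr g * (V powr \<alpha> * V powr b)) * (2 ^ d * 2)"
      using C by (intro mult_left_mono *) auto
    also have "\<dots> = 2 * (C * 2 ^ d * V powr \<kappa> * h powr g) * V" unfolding ** by simp
    finally show "C * (2 ^ d * V) powr \<alpha> * (V powr b * (2 * h) powr g)
        \<le> 2 * (C * 2 ^ d * V powr \<kappa> * h powr g) * V" .
  qed
  also have "\<dots> = (2 * ennreal V) * ennreal (C * 2 ^ d * V powr \<kappa> * h powr g)"
    using C \<open>V > 0\<close> by (simp add: ennreal_mult mult_ac flip: ennreal_numeral)
  finally have "(2 * ennreal V) * emeasure \<rho> I
      \<le> (2 * ennreal V) * ennreal (C * 2 ^ d * V powr \<kappa> * h powr g)"
    by (simp add: mult_ac)
  then have "emeasure \<rho> I \<le> ennreal (C * 2 ^ d * V powr \<kappa> * h powr g)"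
    using \<open>V > 0\<close> by (subst (asm) ennreal_mult_le_mult_iff) (auto simp: ennreal_mult_eq_top_iff)
  then show ?thesis by (simp add: V_def I_def \<kappa>_def g_def)
qed

section \<open>Iterated derivatives of polynomials and Taylor bounds\<close>

text \<open>The operator \<open>vector_derivative\<close> is meaningful only where a derivative
  exists. Differentiation stays within polynomial functions, so every iterate is a genuine
  derivative.\<close>

lemma has_vector_derivative_nth_vderiv:
  fixes P :: "real \<Rightarrow> 'a::euclidean_space"
  assumes "polynomial_function P"
  shows polynomial_function_nth_vderiv: "polynomial_function (nth_vderiv k P)" (is ?A)
    and "(nth_vderiv k P has_vector_derivative nth_vderiv (Suc k) P t) (at t)" (is ?B)
proof -
  have step: "polynomial_function (\<lambda>t. vector_derivative g (at t)) \<and>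
      (\<forall>t. (g has_vector_derivative vector_derivative g (at t)) (at t))"
    if g: "polynomial_function g" for g :: "real \<Rightarrow> 'a"
  proof -
    obtain g' where g': "polynomial_function g'" "\<And>t. (g has_vector_derivative g' t) (at t)"
      using has_vector_derivative_polynomial_function[OF g] by blast
    then have "(\<lambda>t. vector_derivative g (at t)) = g'"
      by (auto simp: fun_eq_iff intro!: vector_derivative_at)
    with g' show ?thesis by (metis (no_types))
  qed
  have A: "polynomial_function (nth_vderiv k P)" for k
    by (induction k) (use assms step in \<open>auto simp: nth_vderiv_def\<close>)
  show ?A by (rule A)
  show ?B using step[OF A[of k]] by (simp add: nth_vderiv_def)
qed

lemma nth_vderiv_0 [simp]: "nth_vderiv 0 P = P"
  by (simp add: nth_vderiv_def)

lemma isCont_nth_vderiv: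
  fixes P :: "real \<Rightarrow> 'a::euclidean_space"
  assumes "polynomial_function P"
  shows "isCont (nth_vderiv k P) t"
  using has_vector_derivative_nth_vderiv[OF assms] has_vector_derivative_continuous by blast

text \<open>The scalar function \<open>v \<bullet> P t\<close> has no Taylor terms of order
  \<open>1\<close> to \<open>m - 1\<close> at \<open>t0\<close>, so only the Lagrange remainder of
  order \<open>m\<close> is left. Continuity moves the \<open>m\<close>-th derivative from the
  intermediate point to \<open>t0\<close> at the cost of \<open>\<eta>\<close>, and the division by
  \<open>fact m\<close> is given away.\<close>

lemma flat_component_bound:
  fixes P :: "real \<Rightarrow> 'a::euclidean_space"
  assumes P: "polynomial_function P" and m: "0 < m" and \<eta>: "0 < \<eta>"
    and flat: "\<And>k. 0 < k \<Longrightarrow> k < m \<Longrightarrow> v \<bullet> nth_vderiv k P t0 = 0"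
  shows "\<exists>\<delta>>0. \<forall>t. \<bar>t - t0\<bar> < \<delta> \<longrightarrow>
    \<bar>v \<bullet> (P t - P t0)\<bar> \<le> (\<bar>v \<bullet> nth_vderiv m P t0\<bar> + \<eta>) * \<bar>t - t0\<bar> ^ m"
proof -
  define g where "g = (\<lambda>k t. v \<bullet> nth_vderiv k P t)"
  have deriv: "(g k has_real_derivative g (Suc k) t) (at t)" for k t
    using bounded_linear.has_vector_derivative[OF bounded_linear_inner_right
        has_vector_derivative_nth_vderiv(2)[OF P]]
    unfolding g_def has_real_derivative_iff_has_vector_derivative .
  have "isCont (g m) t0" using deriv DERIV_isCont by blast
  then obtain \<delta> where \<delta>: "0 < \<delta>" "\<And>t. \<bar>t - t0\<bar> < \<delta> \<Longrightarrow> \<bar>g m t - g m t0\<bar> < \<eta>"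
    using \<eta> by (auto simp: continuous_at_eps_delta dist_real_def)
  have "\<bar>g 0 t - g 0 t0\<bar> \<le> (\<bar>g m t0\<bar> + \<eta>) * \<bar>t - t0\<bar> ^ m" if t: "\<bar>t - t0\<bar> < \<delta>" for t
  proof (cases "t = t0")
    case False
    obtain x where x: "if t < t0 then t < x \<and> x < t0 else t0 < x \<and> x < t"
      "g 0 t = (\<Sum>k<m. g k t0 / fact k * (t - t0) ^ k) + g m x / fact m * (t - t0) ^ m"
      using Taylor[of m g "g 0" "min t t0" "max t t0" t0 t] m deriv False by auto
    have "(\<Sum>k<m. g k t0 / fact k * (t - t0) ^ k) = (\<Sum>k\<in>{0}. g k t0 / fact k * (t - t0) ^ k)"
      using m flat by (intro sum.mono_neutral_right) (auto simp: g_def)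
    then have "\<bar>g 0 t - g 0 t0\<bar> = \<bar>g m x\<bar> / fact m * \<bar>t - t0\<bar> ^ m"
      using x(2) by (simp add: abs_mult power_abs)
    also have "\<dots> \<le> \<bar>g m x\<bar> * \<bar>t - t0\<bar> ^ m"
      by (intro mult_right_mono) (auto simp: divide_le_eq mult_le_cancel_left1)
    also have "\<bar>g m x\<bar> \<le> \<bar>g m t0\<bar> + \<eta>"
      using \<delta>(2)[of x] x(1) t by (auto split: if_splits)
    finally show ?thesis by (simp add: mult_right_mono)
  qed (use \<eta> in auto)
  then show ?thesis using \<delta>(1) by (auto simp: g_def inner_diff_right)
qed

section \<open>Column numbering and the local density bound\<close>

text \<open>Counting the pairs \<open>i \<le> j\<close> by either coordinate replaces
  \<open>{..j}\<close> by \<open>{j..}\<close>, and these two sets overlap only in \<open>j\<close>.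
  The sum is the total power of \<open>h\<close> in the volume of the Knapp box.\<close>

lemma sum_card_atMost:
  "2 * (\<Sum>j::'n::{finite,linorder}\<in>UNIV. card {..j}) = CARD('n) * (CARD('n) + 1)"
proof -
  have "(\<Sum>j::'n\<in>UNIV. card {..j}) = (\<Sum>j::'n\<in>UNIV. \<Sum>i::'n\<in>UNIV. if i \<le> j then 1 else 0)"
    by (simp add: sum.If_cases atMost_def)
  also have "\<dots> = (\<Sum>i::'n\<in>UNIV. \<Sum>j::'n\<in>UNIV. if i \<le> j then 1 else 0)" by (rule sum.swap)
  also have "\<dots> = (\<Sum>j::'n\<in>UNIV. card {j..})"
    by (simp add: sum.If_cases atLeast_def)
  finally have "2 * (\<Sum>j::'n\<in>UNIV. card {..j}) = (\<Sum>j::'n\<in>UNIV. card {..j} + card {j..})"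
    by (simp add: sum.distrib)
  also have "\<dots> = (\<Sum>j::'n\<in>UNIV. CARD('n) + 1)"
  proof (intro sum.cong refl)
    fix j :: 'n
    have "{..j} \<union> {j..} = UNIV" "{..j} \<inter> {j..} = {j}" by auto
    then show "card {..j} + card {j..} = CARD('n) + 1"
      using card_Un_Int[of "{..j}" "{j..}"] by simp
  qed
  finally show ?thesis by simp
qed

text \<open>The rank \<open>card {..i}\<close> is strictly increasing, hence a bijection onto
  \<open>{1..CARD('n)}\<close>. This turns orthogonality to the earlier columns into orthogonality
  to all derivatives of lower positive order.\<close>

lemma card_atMost_surj:
  fixes j :: "'n::{finite,linorder}"
  assumes "0 < k" "k < card {..j}"
  obtains i where "i < j" "card {..i} = k"
proof -
  have strict: "card {..i} < card {..i'}" if "i < i'" for i i' :: 'n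
    using that by (intro psubset_card_mono) auto
  have "inj (\<lambda>i::'n. card {..i})"
    by (rule injI) (metis less_irrefl linorder_neq_iff strict)
  then have "card (range (\<lambda>i::'n. card {..i})) = CARD('n)" by (simp add: card_image)
  moreover have "range (\<lambda>i::'n. card {..i}) \<subseteq> {1..CARD('n)}"
    by (auto simp: Suc_le_eq card_gt_0_iff intro: card_mono[OF finite subset_UNIV])
  ultimately have "range (\<lambda>i::'n. card {..i}) = {1..CARD('n)}"
    by (intro card_subset_eq) auto
  moreover have "k \<in> {1..CARD('n)}"
    using assms card_mono[of UNIV "{..j}"] by auto
  ultimately have "k \<in> range (\<lambda>i::'n. card {..i})" by simp
  then obtain i :: 'n where i: "k = card {..i}" by blast
  then have "i < j" using assms strict[of j i] by (metis less_asym linorder_neq_iff)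
  with i show ?thesis using that by auto
qed

lemma isCont_torsion:
  fixes P :: "real \<Rightarrow> real^'n::{finite,linorder}"
  assumes "polynomial_function P"
  shows "isCont (torsion P) t"
  unfolding torsion_def[abs_def] det_def
  by (simp, intro continuous_intros isCont_nth_vderiv assms)

lemma local_density_bound:
  fixes P :: "real \<Rightarrow> real^'n::{finite,linorder}"
  assumes d: "3 \<le> d" "CARD('n) = d - 1" and \<theta>: "0 \<le> \<theta>" "\<theta> \<le> 1" and C: "0 \<le> C"
    and sets: "sets \<rho> = sets borel"
    and bound: "restricted_xray_bound d \<theta> P \<rho> C" and P: "polynomial_function P"
    and \<epsilon>: "0 < \<epsilon>"
  shows "\<exists>\<delta>>0. \<forall>h. 0 < h \<and> h < \<delta> \<longrightarrow>
    emeasure \<rho> {t0 - h..t0 + h} \<le> ennreal ((4 ^ d * C * torsion_weight d \<theta> P t0 + \<epsilon>) * h)"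
proof -
  define \<kappa> where "\<kappa> = 2 * \<theta> / ((real d + 2) * (real d - 1))"
  have d3: "real d \<ge> 3" using d by simp
  \<comment> \<open>As \<open>2 * \<theta> \<le> 2\<close>, this is ample for
    \<open>\<kappa> \<le> 1\<close>, which later keeps the constant free of \<theta>.\<close>
  have "(real d + 2) * (real d - 1) \<ge> 5 * 2" using d3 by (intro mult_mono) auto
  then have \<kappa>: "0 \<le> \<kappa>" "\<kappa> \<le> 1" "\<kappa> = 0 \<longleftrightarrow> \<theta> = 0" using \<theta> d3 by (auto simp: \<kappa>_def field_simps)
  define M where "M = (\<lambda>j::'n. nth_vderiv (card {..j}) P t0)"
  obtain q where q: "\<And>i. norm (q i) = 1" "\<And>i j. i \<noteq> j \<Longrightarrow> q i \<bullet> q j = 0"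
    "\<And>i k. k < i \<Longrightarrow> q i \<bullet> M k = 0"
    using orthonormal_triangularization[of M] by blast
  have torsion: "(\<Prod>j\<in>UNIV. \<bar>q j \<bullet> M j\<bar>) = \<bar>torsion P t0\<bar>"
    using abs_det_triangularization[OF q] by (simp add: torsion_def M_def)
  define w where "w = (\<lambda>\<eta>. (\<Prod>j\<in>UNIV. \<bar>q j \<bullet> M j\<bar> + \<eta>) powr \<kappa>)"
  have "(w \<longlongrightarrow> torsion_weight d \<theta> P t0) (at_right 0)"
  \<comment> \<open>For \<theta> equal to \<open>0\<close> the weight is \<open>1\<close> by
    convention, whereas the limiting product may vanish and \<open>0 powr 0 = 0\<close>; hence
    \<open>w\<close> is evaluated at positive \<open>\<eta>\<close>, where the product is
    positive.\<close>
  proof (cases "\<theta> = 0")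
    case True
    have "eventually (\<lambda>\<eta>. w \<eta> = 1) (at_right 0)"
      using eventually_at_right_less[of 0]
    proof eventually_elim
      case (elim \<eta>)
      then have "(\<Prod>j\<in>UNIV. \<bar>q j \<bullet> M j\<bar> + \<eta>) > 0" by (intro prod_pos) (auto intro: add_nonneg_pos)
      moreover have "\<kappa> = 0" using True \<kappa> by simp
      ultimately show ?case unfolding w_def by (metis less_irrefl powr_zero_eq_one)
    qed
    then show ?thesis using True by (auto simp: torsion_weight_def intro: tendsto_eventually)
  next
    case False
    have "((\<lambda>\<eta>. \<Prod>j\<in>UNIV. \<bar>q j \<bullet> M j\<bar> + \<eta>) \<longlongrightarrow> (\<Prod>j\<in>UNIV. \<bar>q j \<bullet> M j\<bar> + 0)) (at_right 0)"
      by (intro tendsto_intros)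
    then have "(w \<longlongrightarrow> (\<Prod>j\<in>UNIV. \<bar>q j \<bullet> M j\<bar> + 0) powr \<kappa>) (at_right 0)"
      unfolding w_def using False \<kappa>
      by (intro tendsto_powr' tendsto_const)
         (auto intro!: eventually_mono[OF eventually_at_right_less[of 0]] prod_nonneg)
    then show ?thesis using False torsion by (simp add: torsion_weight_def \<kappa>_def)
  qed
  then have "((\<lambda>\<eta>. 4 ^ d * C * w \<eta>) \<longlongrightarrow> 4 ^ d * C * torsion_weight d \<theta> P t0) (at_right 0)"
    by (intro tendsto_intros)
  then have "eventually (\<lambda>\<eta>. 4 ^ d * C * w \<eta> < 4 ^ d * C * torsion_weight d \<theta> P t0 + \<epsilon>) (at_right 0)"
    using \<epsilon> by (intro order_tendstoD(2)) auto
  then have "eventually (\<lambda>\<eta>. 4 ^ d * C * w \<eta> < 4 ^ d * C * torsion_weight d \<theta> P t0 + \<epsilon> \<and> 0 < \<eta>) (at_right 0)"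
    using eventually_at_right_less[of 0] by (rule eventually_conj)
  \<comment> \<open>One \<open>\<eta>\<close> is fixed before \<open>h\<close> enters. It makes
    every \<open>c j\<close> below positive, so the boxes are nondegenerate even where diagonal
    entries vanish.\<close>
  then obtain \<eta> where \<eta>: "0 < \<eta>" "4 ^ d * C * w \<eta> < 4 ^ d * C * torsion_weight d \<theta> P t0 + \<epsilon>"
    using eventually_happens'[OF trivial_limit_at_right_real] by blast
  define c where "c = (\<lambda>j. \<bar>q j \<bullet> M j\<bar> + \<eta>)"
  have c: "c j > 0" for j using \<eta> by (auto simp: c_def intro: add_nonneg_pos)
  have "\<exists>\<delta>>0. \<forall>t. \<bar>t - t0\<bar> < \<delta> \<longrightarrow> \<bar>q j \<bullet> (P t - P t0)\<bar> \<le> c j * \<bar>t - t0\<bar> ^ card {..j}" for j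
    unfolding c_def M_def
  proof (rule flat_component_bound[OF P _ \<eta>(1)])
    show "0 < card {..j}" by (auto simp: card_gt_0_iff)
    fix k assume "0 < k" "k < card {..j}"
    then obtain i where "i < j" "card {..i} = k" by (rule card_atMost_surj)
    then show "q j \<bullet> nth_vderiv k P t0 = 0" using q(3)[of i j] by (auto simp: M_def)
  qed
  then obtain \<delta> where \<delta>: "\<And>j. 0 < \<delta> j"
    "\<And>j t. \<bar>t - t0\<bar> < \<delta> j \<Longrightarrow> \<bar>q j \<bullet> (P t - P t0)\<bar> \<le> c j * \<bar>t - t0\<bar> ^ card {..j}"
    by metis
  show ?thesis
  proof (intro exI[of _ "Min (range \<delta>)"] conjI allI impI)
    show "0 < Min (range \<delta>)" using \<delta>(1) by (subst Min_gr_iff) auto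
    fix h assume h: "0 < h \<and> h < Min (range \<delta>)"
    then have h: "0 < h" "\<And>j. h < \<delta> j" by auto
    define r where "r = (\<lambda>j::'n. c j * h ^ card {..j})"
    have r: "0 < r j" for j using c h by (simp add: r_def)
    have "\<bar>q j \<bullet> (P t - P t0)\<bar> \<le> r j" if "\<bar>t - t0\<bar> \<le> h" for t j
    proof -
      have "\<bar>q j \<bullet> (P t - P t0)\<bar> \<le> c j * \<bar>t - t0\<bar> ^ card {..j}"
        using that h(2)[of j] by (intro \<delta>(2)) auto
      also have "\<dots> \<le> r j"
        unfolding r_def using that c[of j] by (intro mult_left_mono power_mono) auto
      finally show ?thesis .
    qed
    from knapp_estimate[OF d \<theta> C sets bound q(1,2) r h(1) this]
    have "emeasure \<rho> {t0 - h..t0 + h} \<le>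
       ennreal (C * 2 ^ d * (\<Prod>j\<in>UNIV. 2 * r j) powr \<kappa> * h powr (1 - \<theta> * real d / (real d + 2)))"
      by (simp add: \<kappa>_def)
    also have "\<dots> \<le> ennreal ((4 ^ d * C * torsion_weight d \<theta> P t0 + \<epsilon>) * h)"
    proof (rule ennreal_leI)
      \<comment> \<open>Here \<open>m = d * (d - 1) / 2\<close>, so the volume contributes
        \<open>h powr (\<theta> * d / (d + 2))\<close>, the complement to \<open>h\<close> of the
        power already present.\<close>
      define m where "m = (\<Sum>j::'n\<in>UNIV. card {..j})"
      have "real (2 * m) = real (CARD('n) * (CARD('n) + 1))"
        unfolding m_def sum_card_atMost ..
      then have "2 * real m = (real d - 1) * real d" using d by (simp add: of_nat_diff)
      then have "(2 * real m) * \<theta> / ((real d + 2) * (real d - 1)) = \<theta> * real d / (real d + 2)"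
        using d3 by simp
      then have m\<kappa>: "real m * \<kappa> = \<theta> * real d / (real d + 2)"
        by (simp add: \<kappa>_def mult_ac)
      have "(\<Prod>j\<in>UNIV. 2 * r j) = 2 ^ (d - 1) * (\<Prod>j\<in>UNIV. c j) * h ^ m"
        unfolding r_def m_def using d(2) by (simp add: prod.distrib power_sum)
      then have "(\<Prod>j\<in>UNIV. 2 * r j) powr \<kappa> = (2 ^ (d - 1)) powr \<kappa> * w \<eta> * h powr (real m * \<kappa>)"
        using c h(1)
        by (simp add: powr_mult prod_nonneg less_imp_le w_def c_def powr_powr flip: powr_realpow)
      then have "C * 2 ^ d * (\<Prod>j\<in>UNIV. 2 * r j) powr \<kappa> * h powr (1 - \<theta> * real d / (real d + 2)) =
          C * 2 ^ d * (2 ^ (d - 1)) powr \<kappa> * w \<eta> * (h powr (real m * \<kappa>) * h powr (1 - real m * \<kappa>))"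
        by (simp add: m\<kappa>)
      also have "h powr (real m * \<kappa>) * h powr (1 - real m * \<kappa>) = h"
        using h(1) by (simp flip: powr_add)
      \<comment> \<open>Together with the factor \<open>2 ^ d\<close> of the Knapp estimate this
        produces the constant \<open>4 ^ d\<close>.\<close>
      also have "(2 ^ (d - 1) :: real) powr \<kappa> \<le> 2 ^ d"
      proof -
        have "(2 ^ (d - 1) :: real) powr \<kappa> \<le> (2 ^ (d - 1)) powr 1"
          using \<kappa> by (intro powr_mono) auto
        also have "\<dots> \<le> 2 ^ d" by simp
        finally show ?thesis .
      qed
      also have "C * 2 ^ d * 2 ^ d * w \<eta> * h = 4 ^ d * C * w \<eta> * h"
        by (simp flip: power_mult_distrib)
      also have "\<dots> \<le> (4 ^ d * C * torsion_weight d \<theta> P t0 + \<epsilon>) * h"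
        using \<eta> h(1) by (intro mult_right_mono) auto
      finally show "C * 2 ^ d * (\<Prod>j\<in>UNIV. 2 * r j) powr \<kappa> * h powr (1 - \<theta> * real d / (real d + 2))
          \<le> (4 ^ d * C * torsion_weight d \<theta> P t0 + \<epsilon>) * h"
        using C h(1) by (simp add: mult_mono mult_left_mono mult_right_mono w_def)
    qed
    finally show "emeasure \<rho> {t0 - h..t0 + h} \<le> ennreal ((4 ^ d * C * torsion_weight d \<theta> P t0 + \<epsilon>) * h)" .
  qed
qed

section \<open>From local density bounds to intervals and Borel sets\<close>

text \<open>By bisection it is enough that the inequality passes to unions of adjacent intervals and
  holds for all short intervals around each point. For the latter, continuity keeps \<open>H\<close>
  above \<open>c\<close> near \<open>x\<close>; this is where the strict inequality
  \<open>c < H x\<close> is used.\<close>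

lemma emeasure_Icc_le_density:
  fixes \<rho> :: "real measure"
  assumes sets: "sets \<rho> = sets borel" and H: "\<And>x. isCont H x"
    and loc: "\<And>x. \<exists>c<H x. \<exists>\<delta>>0. \<forall>h. 0 < h \<and> h < \<delta> \<longrightarrow> emeasure \<rho> {x - h..x + h} \<le> ennreal (c * h)"
    and ab: "a \<le> b"
  shows "emeasure \<rho> {a..b} \<le> emeasure (density lborel (\<lambda>x. ennreal (H x))) {a..b}"
  using ab
proof (induction rule: Bolzano)
  have [measurable]: "H \<in> borel_measurable borel"
    using H by (intro borel_measurable_continuous_onI continuous_at_imp_continuous_on) auto
  define \<mu> where "\<mu> = density lborel (\<lambda>x. ennreal (H x))"
  {
    case (trans a b c)
    have "emeasure \<rho> {a..c} \<le> emeasure \<rho> ({a..b} \<union> {b..c})"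
      using sets by (intro emeasure_mono) auto
    also have "\<dots> \<le> emeasure \<rho> {a..b} + emeasure \<rho> {b..c}"
      using sets by (intro emeasure_subadditive) auto
    also have "\<dots> \<le> emeasure \<mu> {a..b} + emeasure \<mu> {b..c}"
      using trans unfolding \<mu>_def by (intro add_mono)
    \<comment> \<open>The shared endpoint is null for the density, so making the second interval
      half open costs nothing and yields a disjoint union.\<close>
    also have "emeasure \<mu> {b..c} = emeasure \<mu> {b<..c}"
      unfolding \<mu>_def using AE_lborel_singleton[of b]
      by (auto simp: emeasure_density indicator_def intro!: nn_integral_cong_AE)
    also have "emeasure \<mu> {a..b} + emeasure \<mu> {b<..c} = emeasure \<mu> ({a..b} \<union> {b<..c})"
      by (rule plus_emeasure) (auto simp: \<mu>_def)
    also have "{a..b} \<union> {b<..c} = {a..c}" using trans by auto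
    finally show ?case by (simp add: \<mu>_def)
  next
    case (local x)
    obtain c \<delta> where c: "c < H x" and \<delta>: "0 < \<delta>"
      "\<And>h. 0 < h \<Longrightarrow> h < \<delta> \<Longrightarrow> emeasure \<rho> {x - h..x + h} \<le> ennreal (c * h)"
      using loc[of x] by blast
    obtain \<gamma> where \<gamma>: "0 < \<gamma>" "\<And>y. \<bar>y - x\<bar> < \<gamma> \<Longrightarrow> c < H y"
    proof -
      have "\<exists>\<gamma>>0. \<forall>y. dist y x < \<gamma> \<longrightarrow> dist (H y) (H x) < H x - c"
        using H[of x] c unfolding continuous_at_eps_delta by simp
      then obtain \<gamma> where \<gamma>: "0 < \<gamma>" "\<And>y. dist y x < \<gamma> \<Longrightarrow> dist (H y) (H x) < H x - c"
        by blast
      have "c < H y" if "\<bar>y - x\<bar> < \<gamma>" for y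
        using \<gamma>(2)[of y] that unfolding dist_real_def by linarith
      with \<gamma>(1) show ?thesis by (rule that)
    qed
    \<comment> \<open>Bisection also asks for degenerate intervals, so atoms must be excluded; the
      local bound does this as \<open>h\<close> tends to \<open>0\<close>.\<close>
    have null: "emeasure \<rho> {x} \<le> 0"
    proof (rule tendsto_lowerbound)
      have "((\<lambda>h. ennreal (c * h)) \<longlongrightarrow> ennreal (c * 0)) (at_right 0)"
        by (intro tendsto_intros)
      then show "((\<lambda>h. ennreal (c * h)) \<longlongrightarrow> 0) (at_right 0)" by simp
      show "eventually (\<lambda>h. emeasure \<rho> {x} \<le> ennreal (c * h)) (at_right 0)"
        using eventually_at_right_real[OF \<delta>(1)]
      proof eventually_elim
        case (elim h)
        then have "emeasure \<rho> {x} \<le> emeasure \<rho> {x - h..x + h}"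
          using sets by (intro emeasure_mono) auto
        also have "\<dots> \<le> ennreal (c * h)" using elim by (intro \<delta>(2)) auto
        finally show ?case .
      qed
    qed simp
    show ?case
    proof (intro exI[of _ "min \<delta> \<gamma>"] conjI allI impI)
      show "0 < min \<delta> \<gamma>" using \<delta> \<gamma> by simp
      fix a b assume ab: "a \<le> x \<and> x \<le> b \<and> b - a < min \<delta> \<gamma>"
      show "emeasure \<rho> {a..b} \<le> emeasure (density lborel (\<lambda>x. ennreal (H x))) {a..b}"
      proof (cases "a = b")
        case True
        then have "{a..b} = {x}" using ab by auto
        then show ?thesis using null by simp
      next
        case False
        \<comment> \<open>Taking the full length makes \<open>{x - h..x + h}\<close> contain
          \<open>{a..b}\<close> wherever \<open>x\<close> lies in it, and \<open>c * h\<close> is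
          exactly the integral of \<open>c\<close> over \<open>{a..b}\<close>.\<close>
        define h where "h = b - a"
        have h: "0 < h" "h < \<delta>" using ab False by (auto simp: h_def)
        have "emeasure \<rho> {a..b} \<le> emeasure \<rho> {x - h..x + h}"
          using sets ab by (intro emeasure_mono) (auto simp: h_def)
        also have "\<dots> \<le> ennreal (c * h)" using h by (rule \<delta>(2))
        also have "\<dots> = (\<integral>\<^sup>+ y. ennreal c * indicator {a..b} y \<partial>lborel)"
          using h by (simp add: nn_integral_cmult_indicator ennreal_mult'' h_def)
        also have "\<dots> \<le> (\<integral>\<^sup>+ y. ennreal (H y) * indicator {a..b} y \<partial>lborel)"
          using less_imp_le[OF \<gamma>(2)] ab by (intro nn_integral_mono) (auto simp: indicator_def intro!: ennreal_leI)
        also have "\<dots> = emeasure (density lborel (\<lambda>x. ennreal (H x))) {a..b}"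
          by (simp add: emeasure_density)
        finally show ?thesis .
      qed
    qed
  }
qed

text \<open>A bounded Borel set is covered by countably many closed intervals with disjoint
  interiors and small Lebesgue excess. Subadditivity suffices on the side of \<open>\<rho>\<close>,
  while the density side is additive because endpoints are null. Boundedness of \<open>H\<close> on
  a compact interval makes the excess small for the density too.\<close>

lemma emeasure_le_density_if_Icc:
  fixes \<rho> :: "real measure"
  assumes sets: "sets \<rho> = sets borel" and H: "continuous_on UNIV H"
    and Icc: "\<And>a b. a \<le> b \<Longrightarrow>
      emeasure \<rho> {a..b} \<le> emeasure (density lborel (\<lambda>x. ennreal (H x))) {a..b}"
    and A: "A \<in> sets borel"
  shows "emeasure \<rho> A \<le> emeasure (density lborel (\<lambda>x. ennreal (H x))) A"
proof -
  have [measurable]: "H \<in> borel_measurable borel"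
    using H by (rule borel_measurable_continuous_onI)
  define \<mu> where "\<mu> = density lborel (\<lambda>x. ennreal (H x))"
  have sets_\<mu> [simp]: "sets \<mu> = sets borel" by (simp add: \<mu>_def)
  have bdd: "emeasure \<rho> A \<le> emeasure \<mu> A" if A [measurable]: "A \<in> sets borel" and sub: "A \<subseteq> {a..b}" for A a b
  proof -
    obtain K where K: "0 < K" "\<And>x. x \<in> {a..b} \<Longrightarrow> \<bar>H x\<bar> \<le> K"
    proof -
      have "bounded (H ` {a..b})"
        using H by (intro compact_imp_bounded compact_continuous_image) (auto intro: continuous_on_subset)
      then obtain K where K: "0 < K" "\<forall>y\<in>H ` {a..b}. norm y \<le> K"
        unfolding bounded_pos by blast
      then have "\<bar>H x\<bar> \<le> K" if "x \<in> {a..b}" for x using that by simp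
      with K(1) show ?thesis by (rule that)
    qed
    have "emeasure \<rho> A \<le> emeasure \<mu> A + ennreal \<epsilon>" if \<epsilon>: "0 < \<epsilon>" for \<epsilon>
    proof -
      have "A \<in> lmeasurable"
        using bounded_subset[OF bounded_closed_interval[of a b] sub] A
        by (intro bounded_set_imp_lmeasurable) auto
      moreover have "A \<subseteq> cbox a b" using sub by simp
      \<comment> \<open>The Lebesgue excess \<open>\<epsilon> / K\<close> becomes at most
        \<open>\<epsilon>\<close> after weighting by \<open>H\<close>, which is at most
        \<open>K\<close> on \<open>{a..b}\<close>.\<close>
      moreover have "0 < \<epsilon> / K" using \<epsilon> K by simp
      ultimately obtain \<D> where \<D>: "countable \<D>"
        "\<And>X. X \<in> \<D> \<Longrightarrow> X \<subseteq> cbox a b \<and> X \<noteq> {} \<and> (\<exists>c d. X = cbox c d)"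
        "pairwise (\<lambda>A B. interior A \<inter> interior B = {}) \<D>"
        "A \<subseteq> \<Union>\<D>" "\<Union>\<D> \<in> lmeasurable" "measure lebesgue (\<Union>\<D>) \<le> measure lebesgue A + \<epsilon> / K"
      proof (rule measurable_outer_intervals_bounded, goal_cases)
        case (1 \<D>)
        show ?case by (rule 1(1)) (fact 1)+
      qed
      \<comment> \<open>An enumeration of the cover, padded with empty sets so that a finite cover
        is treated alike; each nonempty member occurs at one index only.\<close>
      define X where "X = (\<lambda>n. if n \<in> to_nat_on \<D> ` \<D> then from_nat_into \<D> n else {})"
      have X_cases: "X n = {} \<or> (X n \<in> \<D> \<and> to_nat_on \<D> (X n) = n)" for n
        using \<D>(1) by (auto simp: X_def)
      have X_Un: "(\<Union>n. X n) = \<Union>\<D>"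
      proof
        show "(\<Union>n. X n) \<subseteq> \<Union>\<D>" using X_cases by blast
        have "Y = X (to_nat_on \<D> Y)" if "Y \<in> \<D>" for Y using that \<D>(1) by (simp add: X_def)
        then show "\<Union>\<D> \<subseteq> (\<Union>n. X n)" by blast
      qed
      have X_Icc: "X n = {} \<or> (\<exists>c d. c \<le> d \<and> X n = {c..d})" for n
      proof (cases "X n = {}")
        case False
        then have "X n \<in> \<D>" using X_cases by blast
        then obtain c d where cd: "X n = {c..d}" using \<D>(2)[of "X n"] by auto
        then have "c \<le> d" using False by simp
        with cd show ?thesis by blast
      qed simp
      have X_borel [measurable]: "X n \<in> sets borel" for n using X_Icc[of n] by auto
      have UD [measurable]: "\<Union>\<D> \<in> sets borel" unfolding X_Un[symmetric] by measurable
      have small: "emeasure \<mu> (\<Union>\<D> - A) \<le> ennreal \<epsilon>"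
      proof -
        have sub: "\<Union>\<D> \<subseteq> {a..b}" using \<D>(2) by auto
        have "measure lebesgue (\<Union>\<D> - A) \<le> \<epsilon> / K"
          using \<D>(4,5,6) \<open>A \<in> lmeasurable\<close> by (subst measurable_measure_Diff) auto
        moreover have "emeasure lebesgue (\<Union>\<D> - A) = ennreal (measure lebesgue (\<Union>\<D> - A))"
          using \<D>(5) \<open>A \<in> lmeasurable\<close> by (intro emeasure_eq_measure2 fmeasurable.Diff) auto
        ultimately have e: "emeasure lborel (\<Union>\<D> - A) \<le> ennreal (\<epsilon> / K)"
          by (simp add: ennreal_leI)
        have "emeasure \<mu> (\<Union>\<D> - A) = (\<integral>\<^sup>+ x. ennreal (H x) * indicator (\<Union>\<D> - A) x \<partial>lborel)"
          by (simp add: \<mu>_def emeasure_density)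
        also have "\<dots> \<le> (\<integral>\<^sup>+ x. ennreal K * indicator (\<Union>\<D> - A) x \<partial>lborel)"
        proof (rule nn_integral_mono)
          fix x
          show "ennreal (H x) * indicator (\<Union>\<D> - A) x \<le> ennreal K * indicator (\<Union>\<D> - A) x"
          proof (cases "x \<in> \<Union>\<D> - A")
            case True
            then have "x \<in> {a..b}" using sub by blast
            then have "H x \<le> K" using K(2)[of x] by simp
            then show ?thesis using True by (simp add: ennreal_leI)
          qed simp
        qed
        also have "\<dots> = ennreal K * emeasure lborel (\<Union>\<D> - A)"
          by (simp add: nn_integral_cmult_indicator)
        also have "\<dots> \<le> ennreal K * ennreal (\<epsilon> / K)"
          using e by (rule mult_left_mono) simp
        also have "\<dots> = ennreal \<epsilon>"
          using K(1) by (simp flip: ennreal_mult')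
        finally show ?thesis .
      qed
      have "emeasure \<rho> A \<le> emeasure \<rho> (\<Union>n. X n)"
        using \<D>(4) sets by (intro emeasure_mono) (simp_all add: X_Un UD)
      also have "\<dots> \<le> (\<Sum>n. emeasure \<rho> (X n))"
        using sets X_borel by (intro emeasure_subadditive_countably) (simp add: image_subset_iff)
      also have "\<dots> \<le> (\<Sum>n. emeasure \<mu> (X n))"
      proof (rule suminf_le)
        fix n
        show "emeasure \<rho> (X n) \<le> emeasure \<mu> (X n)"
          using X_Icc[of n]
        proof (elim disjE exE conjE)
          fix c d assume "c \<le> d" "X n = {c..d}"
          then show ?thesis using Icc[of c d] by (simp add: \<mu>_def)
        qed simp
      qed (rule summableI)+
      \<comment> \<open>Intervals of the cover may share endpoints; passing to interiors loses no
        mass and gives a disjoint family.\<close>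
      also have "\<dots> = (\<Sum>n. emeasure \<mu> (interior (X n)))"
      proof (intro suminf_cong)
        fix n
        consider "X n = {}" | c d where "X n = {c..d}" using X_Icc[of n] by blast
        then show "emeasure \<mu> (X n) = emeasure \<mu> (interior (X n))"
        proof cases
          case (2 c d)
          have "emeasure \<mu> {c..d} = emeasure \<mu> {c<..<d}"
          proof -
            have "AE x in lborel. ennreal (H x) * indicator {c..d} x = ennreal (H x) * indicator {c<..<d} x"
              using AE_lborel_singleton[of c] AE_lborel_singleton[of d]
              by eventually_elim (auto simp: indicator_def)
            then show ?thesis by (simp add: \<mu>_def emeasure_density nn_integral_cong_AE)
          qed
          then show ?thesis using 2 by simp
        qed simp
      qed
      also have "\<dots> = emeasure \<mu> (\<Union>n. interior (X n))"
      proof (intro suminf_emeasure)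
        show "disjoint_family (\<lambda>n. interior (X n))"
          unfolding disjoint_family_on_def
        proof (intro ballI impI)
          fix m n :: nat assume "m \<noteq> n"
          show "interior (X m) \<inter> interior (X n) = {}"
          proof (cases "X m = {} \<or> X n = {}")
            case False
            then have "X m \<in> \<D>" "X n \<in> \<D>" "X m \<noteq> X n"
              using X_cases[of m] X_cases[of n] \<open>m \<noteq> n\<close> by auto
            then show ?thesis using \<D>(3) by (auto simp: pairwise_def)
          qed auto
        qed
      qed auto
      also have "\<dots> \<le> emeasure \<mu> (\<Union>\<D>)"
        unfolding X_Un[symmetric] by (intro emeasure_mono UN_mono interior_subset) auto
      also have "\<dots> = emeasure \<mu> A + emeasure \<mu> (\<Union>\<D> - A)"
        using \<D>(4) by (subst plus_emeasure) (auto intro!: arg_cong[where f="emeasure \<mu>"])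
      also have "\<dots> \<le> emeasure \<mu> A + ennreal \<epsilon>"
        using small by (rule add_left_mono)
      finally show ?thesis .
    qed
    then show ?thesis by (rule ennreal_le_epsilon)
  qed
  \<comment> \<open>General Borel sets are exhausted by bounded pieces, using continuity from
    below.\<close>
  define S where "S = (\<lambda>n::nat. A \<inter> {- real n..real n})"
  have S: "range S \<subseteq> sets borel" using A by (auto simp: S_def)
  have "incseq S" by (auto simp: S_def incseq_def)
  have "(\<Union>n. S n) = A"
  proof -
    have "\<exists>n. x \<in> {- real n..real n}" for x :: real
      using real_arch_simple[of "\<bar>x\<bar>"] by (auto simp: abs_le_iff minus_le_iff)
    then show ?thesis by (auto simp: S_def)
  qed
  have "emeasure \<rho> A = (SUP n. emeasure \<rho> (S n))"
    using S sets \<open>incseq S\<close> by (subst SUP_emeasure_incseq) (auto simp: \<open>(\<Union>n. S n) = A\<close>)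
  also have "\<dots> \<le> emeasure \<mu> A"
  proof (rule SUP_least)
    fix n
    have "emeasure \<rho> (S n) \<le> emeasure \<mu> (S n)"
      using S by (intro bdd[of _ "- real n" "real n"]) (auto simp: S_def)
    also have "\<dots> \<le> emeasure \<mu> A" using A by (intro emeasure_mono) (auto simp: S_def)
    finally show "emeasure \<rho> (S n) \<le> emeasure \<mu> A" .
  qed
  finally show ?thesis by (simp add: \<mu>_def)
qed

section \<open>Bounding the Radon-Nikodym derivative\<close>

text \<open>If the derivative were at least \<open>G + 2 * \<epsilon>\<close> on a bounded set of
  positive measure, the measure of that set would exceed the integral of
  \<open>G + \<epsilon>\<close> over it, against \<open>le\<close>. Letting
  \<open>\<epsilon>\<close> run through a null sequence removes it from the bound.\<close>

lemma RN_deriv_le_if_le_density: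
  fixes \<rho> :: "real measure" and G :: "real \<Rightarrow> real"
  assumes sets: "sets \<rho> = sets borel" and G: "continuous_on UNIV G" "\<And>x. 0 \<le> G x"
    and le: "\<And>A \<epsilon>. A \<in> sets borel \<Longrightarrow> 0 < \<epsilon> \<Longrightarrow>
      emeasure \<rho> A \<le> emeasure (density lborel (\<lambda>x. ennreal (G x + \<epsilon>))) A"
  shows "absolutely_continuous lborel \<rho>" (is ?A)
    and "AE t in lborel. RN_deriv lborel \<rho> t \<le> ennreal (G t)" (is ?B)
proof -
  have [measurable]: "G \<in> borel_measurable borel"
    using G(1) by (rule borel_measurable_continuous_onI)
  show ?A
    unfolding absolutely_continuous_def
  proof
    fix N :: "real set" assume N: "N \<in> null_sets lborel"
    then have "N \<in> null_sets (density lborel (\<lambda>x. ennreal (G x + 1)))"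
      using absolutely_continuousI_density[of "\<lambda>x. ennreal (G x + 1)" lborel]
      by (auto simp: absolutely_continuous_def)
    then show "N \<in> null_sets \<rho>"
      using le[of N 1] N sets by (auto simp: null_sets_def)
  qed
  define f where "f = RN_deriv lborel \<rho>"
  have [measurable]: "f \<in> borel_measurable borel"
    using borel_measurable_RN_deriv[of lborel \<rho>] by (simp add: f_def)
  have f: "density lborel f = \<rho>"
    unfolding f_def using \<open>?A\<close> sets by (intro sigma_finite_measure.density_RN_deriv[OF sigma_finite_lborel]) auto
  have "AE t in lborel. f t < ennreal (G t + 2 * \<epsilon>)" if \<epsilon>: "0 < \<epsilon>" for \<epsilon>
  proof -
    define A where "A = {t. ennreal (G t + 2 * \<epsilon>) \<le> f t}"
    define S where "S = (\<lambda>n::nat. A \<inter> {- real n..real n})"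
    have [measurable]: "A \<in> sets borel" unfolding A_def by measurable
    have [measurable]: "S n \<in> sets borel" for n unfolding S_def by measurable
    have "emeasure lborel (S n) = 0" for n
    proof -
      define I where "I = (\<integral>\<^sup>+ t. ennreal (G t + \<epsilon>) * indicator (S n) t \<partial>lborel)"
      \<comment> \<open>Finiteness, from the boundedness of \<open>S n\<close> and the continuity of
        \<open>G\<close>, allows \<open>I\<close> to be cancelled below.\<close>
      have "I \<noteq> \<infinity>"
      proof -
        have "bounded (G ` {- real n..real n})"
          using G(1) by (intro compact_imp_bounded compact_continuous_image) (auto intro: continuous_on_subset)
        then obtain K where "\<forall>y\<in>G ` {- real n..real n}. norm y \<le> K"
          unfolding bounded_iff by blast
        then have K: "\<bar>G x\<bar> \<le> K" if "x \<in> {- real n..real n}" for x using that by simp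
        have "I \<le> (\<integral>\<^sup>+ t. ennreal (K + \<epsilon>) * indicator {- real n..real n} t \<partial>lborel)"
          unfolding I_def
        proof (rule nn_integral_mono)
          fix t
          show "ennreal (G t + \<epsilon>) * indicator (S n) t \<le> ennreal (K + \<epsilon>) * indicator {- real n..real n} t"
            using K[of t] by (auto simp: S_def indicator_def abs_le_iff intro!: ennreal_leI)
        qed
        also have "\<dots> < \<infinity>"
          by (simp add: nn_integral_cmult_indicator ennreal_mult_less_top)
        finally show ?thesis by simp
      qed
      have "I + ennreal \<epsilon> * emeasure lborel (S n) =
          (\<integral>\<^sup>+ t. ennreal (G t + \<epsilon>) * indicator (S n) t + ennreal \<epsilon> * indicator (S n) t \<partial>lborel)"
        unfolding I_def by (subst nn_integral_add) (auto simp: nn_integral_cmult_indicator)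
      also have "\<dots> \<le> (\<integral>\<^sup>+ t. f t * indicator (S n) t \<partial>lborel)"
        using G(2) \<epsilon>
        by (intro nn_integral_mono)
           (auto simp: S_def A_def indicator_def add.assoc simp flip: ennreal_plus)
      also have "\<dots> = emeasure \<rho> (S n)"
        by (subst f[symmetric], subst emeasure_density) auto
      also have "\<dots> \<le> I + 0"
        using le[of "S n" \<epsilon>] \<epsilon> by (simp add: I_def emeasure_density)
      finally have "ennreal \<epsilon> * emeasure lborel (S n) \<le> 0"
        using \<open>I \<noteq> \<infinity>\<close> by (subst (asm) ennreal_add_left_cancel_le) auto
      then show ?thesis using \<epsilon> by simp
    qed
    then have "(\<Union>n. S n) \<in> null_sets lborel" by (intro null_sets_UN) (auto simp: null_sets_def)
    moreover have "(\<Union>n. S n) = A"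
    proof -
      have "\<exists>n. x \<in> {- real n..real n}" for x :: real
        using real_arch_simple[of "\<bar>x\<bar>"] by (auto simp: abs_le_iff minus_le_iff)
      then show ?thesis by (auto simp: S_def)
    qed
    ultimately have "A \<in> null_sets lborel" by simp
    then show ?thesis by (rule AE_I') (auto simp: A_def not_less)
  qed
  \<comment> \<open>Only countably many values of \<open>\<epsilon>\<close> are used, so that the
    exceptional sets combine to a null set.\<close>
  then have "AE t in lborel. \<forall>n. f t < ennreal (G t + 2 * inverse (real (Suc n)))"
    by (subst AE_all_countable) simp
  then show ?B
    unfolding f_def[symmetric]
  proof eventually_elim
    case (elim t)
    have "(\<lambda>n. ennreal (G t + 2 * inverse (real (Suc n)))) \<longlonglongrightarrow> ennreal (G t + 2 * 0)"
      by (intro tendsto_intros LIMSEQ_inverse_real_of_nat)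
    then show ?case
      using elim by (intro LIMSEQ_le_const[where X="\<lambda>n. ennreal (G t + 2 * inverse (real (Suc n)))"])
        (auto intro: less_imp_le)
  qed
qed

theorem proposition3p3:
  fixes d :: nat
  assumes "d \<ge> 3" and "CARD('n::{finite,linorder}) = d - 1"
  shows "\<exists>C\<^sub>d :: real. C\<^sub>d > 0 \<and>
    (\<forall>(P :: real \<Rightarrow> real ^ 'n::{finite,linorder}) (\<theta> :: real) (\<rho> :: real measure) (C :: real).
       polynomial_function P \<longrightarrow> 0 \<le> \<theta> \<longrightarrow> \<theta> \<le> 1 \<longrightarrow> sets \<rho> = sets borel \<longrightarrow> 0 \<le> C \<longrightarrow>
       restricted_xray_bound d \<theta> P \<rho> C \<longrightarrow>
       absolutely_continuous lborel \<rho> \<and>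
       (AE t in lborel. RN_deriv lborel \<rho> t \<le> ennreal (C\<^sub>d * C * torsion_weight d \<theta> P t)))"
proof (intro exI[of _ "4 ^ d"] conjI allI impI)
  show "(0::real) < 4 ^ d" by simp
  fix P :: "real \<Rightarrow> real ^ 'n::_" and \<theta> C :: real and \<rho> :: "real measure"
  assume P: "polynomial_function P" and \<theta>: "0 \<le> \<theta>" "\<theta> \<le> 1" and sets: "sets \<rho> = sets borel"
    and C: "0 \<le> C" and bound: "restricted_xray_bound d \<theta> P \<rho> C"
  define G where "G = (\<lambda>t. 4 ^ d * C * torsion_weight d \<theta> P t)"
  have G_nonneg: "0 \<le> G t" for t using C by (simp add: G_def torsion_weight_def)
  \<comment> \<open>At zeros of the torsion, continuity of the power needs a positive exponent; for
    \<theta> equal to \<open>0\<close> the weight is constant.\<close>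
  have "isCont (torsion_weight d \<theta> P) t" for t
  proof (cases "\<theta> = 0")
    case False
    then have "0 < 2 * \<theta> / ((real d + 2) * (real d - 1))" using \<theta> assms(1) by simp
    then show ?thesis
      unfolding torsion_weight_def[abs_def] isCont_def using False isCont_torsion[OF P, of t]
      by (auto simp: isCont_def intro!: tendsto_powr' tendsto_rabs tendsto_const)
  qed (simp add: torsion_weight_def[abs_def])
  then have G_cont: "isCont G t" for t unfolding G_def by (intro continuous_intros)
  have "emeasure \<rho> A \<le> emeasure (density lborel (\<lambda>x. ennreal (G x + \<epsilon>))) A"
    if "A \<in> sets borel" "0 < \<epsilon>" for A \<epsilon>
  proof (rule emeasure_le_density_if_Icc[OF sets _ _ \<open>A \<in> sets borel\<close>])
    show "continuous_on UNIV (\<lambda>x. G x + \<epsilon>)"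
      using G_cont by (intro continuous_at_imp_continuous_on ballI continuous_intros)
    fix a b :: real assume "a \<le> b"
    then show "emeasure \<rho> {a..b} \<le> emeasure (density lborel (\<lambda>x. ennreal (G x + \<epsilon>))) {a..b}"
    proof (rule emeasure_Icc_le_density[OF sets, rotated 2])
      show "isCont (\<lambda>x. G x + \<epsilon>) x" for x using G_cont by (intro continuous_intros)
      \<comment> \<open>Half of \<open>\<epsilon>\<close> goes into the local bound, and the other
        half gives the strict inequality below \<open>G x + \<epsilon>\<close>.\<close>
      show "\<exists>c<G x + \<epsilon>. \<exists>\<delta>>0. \<forall>h. 0 < h \<and> h < \<delta> \<longrightarrow> emeasure \<rho> {x - h..x + h} \<le> ennreal (c * h)" for x
        using local_density_bound[OF assms \<theta> C sets bound P, of "\<epsilon> / 2" x] \<open>0 < \<epsilon>\<close>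
        by (intro exI[of _ "G x + \<epsilon> / 2"]) (auto simp: G_def)
    qed
  qed
  note le = this
  have "continuous_on UNIV G" using G_cont by (simp add: continuous_at_imp_continuous_on)
  note RN = RN_deriv_le_if_le_density[OF sets this G_nonneg le]
  show "absolutely_continuous lborel \<rho>" by (rule RN)
  show "AE t in lborel. RN_deriv lborel \<rho> t \<le> ennreal (4 ^ d * C * torsion_weight d \<theta> P t)"
    using RN(2) by (simp add: G_def)
qed

end
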